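(* For every integer $k \geq 1$, \[ \frac{1}{4} \left( -\frac{1}{2k+5}+\frac{4}{2k+4}- \frac{5}{2k+3} + \frac{4}{2k+1} \right) < \left| \frac{\pi}{4} - GLS_k \right| < \frac{1}{4} \left( \frac{1}{2k+3} - \frac{4}{2k+2} + \frac{5}{2k+1} \right), \] or equivalently \[ \frac{4k^3+26k^2+58k+47}{16k^4+104k^3+236k^2+214k+60} < \left| \frac{\pi}{4} - GLS_k \right| < \frac{2k^2+6k+5}{8k^3+24k^2+22k+6}. \]
   Context: For an integer $k \geq 1$, $GLS_k$ denotes the $k$th partial sum of the Gregory-Leibniz series, $GLS_k := \sum_{i=1}^{k} (-1)^{i+1} \frac{1}{2i-1}$. *)

theory Defs
  imports Complex_Main
begin

definition GLS :: "nat \<Rightarrow> real" where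
  "GLS k = (\<Sum>i = 1..k. (-1) ^ (i + 1) * (1 / (2 * real i - 1)))"

end

theory Submission
  imports Defs "HOL-Real_Asymp.Real_Asymp"
begin

text \<open>
  The signed remainder \<open>r k = (-1)^k (pi/4 - GLS k)\<close> tends to \<open>0\<close> and satisfies
  \<open>r k + r (k + 1) = 1 / (2k + 1)\<close>. The upper bound \<open>U k\<close> is chosen such that
  \<open>U k + U (k + 1) - 1 / (2k + 1)\<close> is a quarter of the fourth difference of \<open>1 / x\<close>, namely
  \<open>6 / ((2k + 1)(2k + 2)(2k + 3)(2k + 4)(2k + 5))\<close>. This is strictly decreasing in \<open>k\<close>,
  so \<open>U k - r k\<close> strictly decreases to \<open>0\<close> along steps of length two, whence \<open>r k < U k\<close>.
  The lower bound is \<open>1 / (2k + 1) - U (k + 1)\<close>, so it follows from the upper bound at \<open>k + 1\<close>.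
\<close>

lemma pos_if_consecutive_sums_decreasing:
  fixes f :: "nat \<Rightarrow> real"
  assumes lim: "f \<longlonglongrightarrow> 0"
    and dec: "\<And>n. f (Suc n) + f (Suc (Suc n)) < f n + f (Suc n)"
  shows "f n > 0"
proof -
  define g where "g j = f (n + 2 * j)" for j
  \<comment> \<open>The middle term \<open>f (Suc n)\<close> occurs on both sides of
    \<open>dec\<close> and cancels.\<close>
  have "g (Suc j) < g j" for j
    using dec[of "n + 2 * j"] by (simp add: g_def)
  then have "decseq g" and less: "g 1 < g 0"
    by (auto simp: decseq_Suc_iff less_imp_le)
  moreover have "filterlim (\<lambda>j. n + 2 * j) sequentially sequentially"
    by (rule filterlim_subseq) (auto simp: strict_mono_def)
  then have "g \<longlonglongrightarrow> 0"
    unfolding g_def by (rule filterlim_compose[OF lim])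
  \<comment> \<open>The limit only gives a weak inequality, so it is applied at \<open>g 1\<close>;
    the strict drop from \<open>g 0\<close> to \<open>g 1\<close> then makes \<open>f n\<close>
    positive.\<close>
  ultimately have "g 1 \<ge> 0"
    by (simp add: decseq_ge)
  with less show ?thesis
    by (simp add: g_def)
qed

lemma GLS_Suc: "GLS (Suc k) = GLS k + (-1) ^ k / (2 * real k + 1)"
  by (simp add: GLS_def)

text \<open>Shifts the index to start at 0, in the shape of the arctan series at 1 used by
  \<open>pi_series\<close>.\<close>

lemma GLS_eq_sum_lessThan: "GLS k = (\<Sum>i<k. (-1) ^ i * (1 / real (i * 2 + 1)))"
  by (induction k) (simp_all add: GLS_Suc, simp_all add: GLS_def mult.commute)

lemma GLS_tendsto: "GLS \<longlonglongrightarrow> pi / 4"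
proof -
  have "summable (\<lambda>i. (-1) ^ i * (1 / real (i * 2 + 1) * 1 ^ (i * 2 + 1)) :: real)"
    using summable_arctan_series[of 1] by simp
  then have "(\<lambda>i. (-1) ^ i * (1 / real (i * 2 + 1))) sums (pi / 4)"
    by (simp add: pi_series summable_sums)
  then show ?thesis
    unfolding sums_def GLS_eq_sum_lessThan[symmetric] .
qed

definition GLS_remainder :: "nat \<Rightarrow> real" where
  "GLS_remainder k = (-1) ^ k * (pi / 4 - GLS k)"

lemma abs_GLS_remainder: "\<bar>GLS_remainder k\<bar> = \<bar>pi / 4 - GLS k\<bar>"
  by (simp add: GLS_remainder_def abs_mult)

lemma GLS_remainder_add_Suc:
  "GLS_remainder k + GLS_remainder (Suc k) = 1 / (2 * real k + 1)"
  by (simp add: GLS_remainder_def GLS_Suc algebra_simps flip: power_add)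

lemma GLS_remainder_tendsto: "GLS_remainder \<longlonglongrightarrow> 0"
\<comment> \<open>The factor \<open>(-1) ^ k\<close> has no limit, but it disappears under absolute
  values.\<close>
proof (rule tendsto_rabs_zero_cancel)
  show "(\<lambda>k. \<bar>GLS_remainder k\<bar>) \<longlonglongrightarrow> 0"
    unfolding abs_GLS_remainder
    using tendsto_rabs[OF tendsto_diff[OF tendsto_const GLS_tendsto, of "pi / 4"]] by simp
qed

definition GLS_upper :: "nat \<Rightarrow> real" where
  "GLS_upper k = 1 / 4 * (1 / (2 * real k + 3) - 4 / (2 * real k + 2) + 5 / (2 * real k + 1))"

text \<open>The coefficients are the signed binomials of order 4, and 24 is 4!, as for iterated
  differences of \<open>1 / x\<close> in general.\<close>

lemma fourth_difference_inverse:
  fixes x :: real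
  assumes "x > 0"
  shows "1 / x - 4 / (x + 1) + 6 / (x + 2) - 4 / (x + 3) + 1 / (x + 4)
    = 24 / (x * (x + 1) * (x + 2) * (x + 3) * (x + 4))"
proof -
  have "x \<noteq> 0" "x + 1 \<noteq> 0" "x + 2 \<noteq> 0" "x + 3 \<noteq> 0" "x + 4 \<noteq> 0"
    using assms by auto
  then show ?thesis
    by (simp add: divide_simps) algebra
qed

lemma GLS_upper_add_Suc:
  fixes k :: nat
  defines "x \<equiv> 2 * real k + 1"
  shows "GLS_upper k + GLS_upper (Suc k)
    = 1 / x + 6 / (x * (x + 1) * (x + 2) * (x + 3) * (x + 4))"
proof -
  have "GLS_upper k = 1 / 4 * (1 / (x + 2) - 4 / (x + 1) + 5 / x)"
    and "GLS_upper (Suc k) = 1 / 4 * (1 / (x + 4) - 4 / (x + 3) + 5 / (x + 2))"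
    by (simp_all add: GLS_upper_def x_def add_ac)
  \<comment> \<open>Since \<open>Suc k\<close> shifts \<open>x\<close> by 2, the two terms over
    \<open>x + 2\<close> merge to \<open>6 / (x + 2)\<close>; splitting \<open>5 / x\<close> into
    \<open>4 / x\<close> and \<open>1 / x\<close> isolates the main term
    \<open>1 / x\<close>.\<close>
  then have "GLS_upper k + GLS_upper (Suc k)
    = 1 / x + 1 / 4 * (1 / x - 4 / (x + 1) + 6 / (x + 2) - 4 / (x + 3) + 1 / (x + 4))"
    by (simp add: add_divide_distrib diff_divide_distrib)
  moreover have "x > 0"
    by (simp add: x_def)
  ultimately show ?thesis
    by (simp add: fourth_difference_inverse)
qed

lemma GLS_remainder_less_upper: "GLS_remainder k < GLS_upper k"
proof -
  define f where "f n = GLS_upper n - GLS_remainder n" for n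
  define e :: "real \<Rightarrow> real" where "e x = 6 / (x * (x + 1) * (x + 2) * (x + 3) * (x + 4))" for x
  \<comment> \<open>The main terms \<open>1 / (2 * real n + 1)\<close> of the two recurrences
    cancel.\<close>
  have sum: "f n + f (Suc n) = e (2 * real n + 1)" for n
    using GLS_upper_add_Suc[of n] GLS_remainder_add_Suc[of n] by (simp add: f_def e_def)
  have e_less: "e y < e x" if "0 < x" "x < y" for x y
    unfolding e_def using that
    by (intro divide_strict_left_mono mult_strict_mono mult_pos_pos) auto
  have "GLS_upper \<longlonglongrightarrow> 0"
    unfolding GLS_upper_def by real_asymp
  then have "f \<longlonglongrightarrow> 0"
    unfolding f_def using tendsto_diff[OF _ GLS_remainder_tendsto] by fastforce
  moreover have "f (Suc n) + f (Suc (Suc n)) < f n + f (Suc n)" for n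
    unfolding sum by (rule e_less) auto
  ultimately have "f k > 0"
    by (rule pos_if_consecutive_sums_decreasing)
  then show ?thesis
    by (simp add: f_def)
qed

definition GLS_lower :: "nat \<Rightarrow> real" where
  "GLS_lower k = 1 / 4 * (- (1 / (2 * real k + 5)) + 4 / (2 * real k + 4) - 5 / (2 * real k + 3)
     + 4 / (2 * real k + 1))"

lemma GLS_lower_less_remainder: "GLS_lower k < GLS_remainder k"
proof -
  have "GLS_lower k = 1 / (2 * real k + 1) - GLS_upper (Suc k)"
    by (simp add: GLS_lower_def GLS_upper_def algebra_simps)
  then show ?thesis
    using GLS_remainder_less_upper[of "Suc k"] GLS_remainder_add_Suc[of k] by simp
qed

lemma GLS_upper_eq:
  "GLS_upper k = (2 * real k ^ 2 + 6 * real k + 5)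
     / (8 * real k ^ 3 + 24 * real k ^ 2 + 22 * real k + 6)"
proof -
  define x where "x = real k"
  have nz: "2 * x + 1 \<noteq> 0" "2 * x + 2 \<noteq> 0" "2 * x + 3 \<noteq> 0"
    using of_nat_0_le_iff[of k, where 'a = real] unfolding x_def by linarith+
  \<comment> \<open>The factored form reuses the denominators of the partial fractions, so
    \<open>nz\<close> suffices to clear them all.\<close>
  have den: "8 * x ^ 3 + 24 * x ^ 2 + 22 * x + 6 = (2 * x + 1) * (2 * x + 2) * (2 * x + 3)"
    by algebra
  show ?thesis
    unfolding GLS_upper_def x_def[symmetric] den using nz by (simp add: divide_simps) algebra
qed

lemma GLS_lower_eq:
  "GLS_lower k = (4 * real k ^ 3 + 26 * real k ^ 2 + 58 * real k + 47)
     / (16 * real k ^ 4 + 104 * real k ^ 3 + 236 * real k ^ 2 + 214 * real k + 60)"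
proof -
  define x where "x = real k"
  have nz: "2 * x + 1 \<noteq> 0" "2 * x + 3 \<noteq> 0" "2 * x + 4 \<noteq> 0" "2 * x + 5 \<noteq> 0"
    using of_nat_0_le_iff[of k, where 'a = real] unfolding x_def by linarith+
  have den: "16 * x ^ 4 + 104 * x ^ 3 + 236 * x ^ 2 + 214 * x + 60
    = (2 * x + 1) * (2 * x + 3) * (2 * x + 4) * (2 * x + 5)"
    by algebra
  show ?thesis
    unfolding GLS_lower_def x_def[symmetric] den using nz by (simp add: divide_simps) algebra
qed

theorem proposition2:
  fixes k :: nat
  assumes "k \<ge> 1"
  shows "(1 / 4 * (- (1 / (2 * real k + 5)) + 4 / (2 * real k + 4) - 5 / (2 * real k + 3)
              + 4 / (2 * real k + 1)) < \<bar>pi / 4 - GLS k\<bar>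
          \<and> \<bar>pi / 4 - GLS k\<bar>
             < 1 / 4 * (1 / (2 * real k + 3) - 4 / (2 * real k + 2) + 5 / (2 * real k + 1)))
       \<and> ((4 * real k ^ 3 + 26 * real k ^ 2 + 58 * real k + 47)
             / (16 * real k ^ 4 + 104 * real k ^ 3 + 236 * real k ^ 2 + 214 * real k + 60)
             < \<bar>pi / 4 - GLS k\<bar>
          \<and> \<bar>pi / 4 - GLS k\<bar>
             < (2 * real k ^ 2 + 6 * real k + 5)
               / (8 * real k ^ 3 + 24 * real k ^ 2 + 22 * real k + 6))"
proof -
  \<comment> \<open>The single fraction has only positive coefficients, which the partial fractions
    hide. Hence the remainder is positive and equals its absolute value.\<close>
  have "GLS_lower k \<ge> 0"
    unfolding GLS_lower_eq by simp
  with GLS_lower_less_remainder[of k] have "\<bar>pi / 4 - GLS k\<bar> = GLS_remainder k"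
    by (simp flip: abs_GLS_remainder)
  then have "GLS_lower k < \<bar>pi / 4 - GLS k\<bar> \<and> \<bar>pi / 4 - GLS k\<bar> < GLS_upper k"
    using GLS_lower_less_remainder GLS_remainder_less_upper by simp
  \<comment> \<open>Folding turns both forms of the bounds into the same two inequalities.\<close>
  then show ?thesis
    unfolding GLS_lower_eq[symmetric] GLS_upper_eq[symmetric]
      GLS_lower_def[symmetric] GLS_upper_def[symmetric] by blast
qed

end
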